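(* Let $\mathbf{c}$ denote the cardinality of the continuum. Then $\operatorname{Lip}_0(\ell_\infty)$ is isomorphic to $\operatorname{Lip}_0(c_0(\mathbf{c}))$.
   Context: $\ell_\infty$ is the Banach space of bounded real sequences with the sup norm. $\operatorname{Lip}_0(X)$ is the Banach space of real Lipschitz functions on the Banach space $X$ vanishing at $0$, with norm the smallest Lipschitz constant. $c_0(\mathbf{c})$ is the space of real families $(a_i)_{i\in\varGamma}$, $|\varGamma|=\mathbf{c}$, such that for every $\epsilon>0$ only finitely many $|a_i|\ge\epsilon$, with the sup norm. *)

theory Defs
  imports "HOL-Analysis.Analysis"
begin

definition sup_dist :: "('i \<Rightarrow> real) \<Rightarrow> ('i \<Rightarrow> real) \<Rightarrow> real" where
  "sup_dist x y = (SUP i. \<bar>x i - y i\<bar>)"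

definition linf :: "(nat \<Rightarrow> real) set" where
  "linf = {x. bounded (range x)}"

text \<open>c_0(Gamma): families with only finitely many entries of absolute value at least eps,
  for every eps > 0. Taking Gamma = UNIV :: real set gives |Gamma| = continuum.\<close>
definition c0 :: "('i \<Rightarrow> real) set" where
  "c0 = {x. \<forall>e>0. finite {i. e \<le> \<bar>x i\<bar>}}"

text \<open>Lip_0(X): real Lipschitz functions on X vanishing at 0 (extended by 0 outside X,
  so that functions are identified with their restriction to X).\<close>
definition Lip0 :: "('i \<Rightarrow> real) set \<Rightarrow> (('i \<Rightarrow> real) \<Rightarrow> real) set" where
  "Lip0 X = {f. f (\<lambda>_. 0) = 0 \<and> (\<exists>L. \<forall>x\<in>X. \<forall>y\<in>X. \<bar>f x - f y\<bar> \<le> L * sup_dist x y)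
              \<and> (\<forall>x. x \<notin> X \<longrightarrow> f x = 0)}"

definition lipnorm :: "('i \<Rightarrow> real) set \<Rightarrow> (('i \<Rightarrow> real) \<Rightarrow> real) \<Rightarrow> real" where
  "lipnorm X f = Inf {L. 0 \<le> L \<and> (\<forall>x\<in>X. \<forall>y\<in>X. \<bar>f x - f y\<bar> \<le> L * sup_dist x y)}"

definition lip0_isomorphic :: "('i \<Rightarrow> real) set \<Rightarrow> ('j \<Rightarrow> real) set \<Rightarrow> bool" where
  "lip0_isomorphic X Y \<longleftrightarrow>
     (\<exists>T. bij_betw T (Lip0 X) (Lip0 Y)
        \<and> (\<forall>f\<in>Lip0 X. \<forall>g\<in>Lip0 X. \<forall>a b. T (\<lambda>x. a * f x + b * g x) = (\<lambda>y. a * T f y + b * T g y))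
        \<and> (\<exists>C>0. \<forall>f\<in>Lip0 X. lipnorm Y (T f) \<le> C * lipnorm X f \<and> lipnorm X f \<le> C * lipnorm Y (T f)))"

end

theory Submission
  imports Defs "HOL-Library.Function_Algebras"
begin

text \<open>Let \<open>Z\<close> be the \<open>l_infinity\<close>-sum, over continuum many indices for each \<open>n\<close>, of the spaces
  \<open>Lip0 (cube n)\<close>, where \<open>cube n\<close> is the unit ball of \<open>l_infinity^n\<close>; let \<open>X\<close> be \<open>l_infinity\<close> or
  \<open>c_0(c)\<close>. The space \<open>X\<close> is approximated by continuum many multiples of cubes, in such a way that
  finitely many points of \<open>X\<close> are almost fixed by retractions (sampling one coordinate in each
  class of a finite partition, respectively restricting to finitely many coordinates). Restricting
  a function to these cubes, and going back by a limit along an ultrafilter, makes \<open>Lip0 X\<close> complemented in \<open>Z\<close>.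
  Conversely \<open>X\<close> contains continuum many uniformly separated points; placing a cube around each and
  extending by means of bump functions makes the space of bounded sequences in \<open>Z\<close> complemented in
  \<open>Lip0 X\<close>. Pelczynski's decomposition method then identifies \<open>Lip0 X\<close> with that space, which does
  not depend on \<open>X\<close>.\<close>

section \<open>Pointwise vector space structure on functions\<close>

instantiation "fun" :: (type, real_vector) real_vector
begin

definition scaleR_fun :: "real \<Rightarrow> ('a \<Rightarrow> 'b) \<Rightarrow> 'a \<Rightarrow> 'b"
  where "scaleR_fun a f = (\<lambda>x. a *\<^sub>R f x)"

instance
  by standard (auto simp: scaleR_fun_def fun_eq_iff scaleR_add_right scaleR_add_left)

end

lemma scaleR_fun_apply [simp]: "(a *\<^sub>R f) x = a *\<^sub>R f x"
  by (simp add: scaleR_fun_def)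

section \<open>Normed spaces as gauges\<close>

text \<open>A normed space is encoded by the relation \<open>B f C\<close>, read ``\<open>f\<close> belongs to the space
  and has norm at most \<open>C\<close>''.\<close>

definition gauge_rel :: "('a::real_vector \<Rightarrow> real \<Rightarrow> bool) \<Rightarrow> bool" where
  "gauge_rel B \<longleftrightarrow> B 0 0
     \<and> (\<forall>f g C D. B f C \<longrightarrow> B g D \<longrightarrow> B (f + g) (C + D))
     \<and> (\<forall>f C a. B f C \<longrightarrow> B (a *\<^sub>R f) (\<bar>a\<bar> * C))
     \<and> (\<forall>f C D. B f C \<longrightarrow> C \<le> D \<longrightarrow> B f D)
     \<and> (\<forall>f C. B f C \<longrightarrow> 0 \<le> C)"

definition space_of :: "('a \<Rightarrow> real \<Rightarrow> bool) \<Rightarrow> 'a set" where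
  "space_of B = {f. \<exists>C. B f C}"

text \<open>Operators are functions on the whole type, so linearity is required only on the space: a
  map given by limits need not be linear elsewhere.\<close>

definition bounded_op ::
    "('a::real_vector \<Rightarrow> real \<Rightarrow> bool) \<Rightarrow> ('b::real_vector \<Rightarrow> real \<Rightarrow> bool) \<Rightarrow> ('a \<Rightarrow> 'b) \<Rightarrow> bool" where
  "bounded_op A B T \<longleftrightarrow>
     (\<forall>f\<in>space_of A. \<forall>g\<in>space_of A. T (f + g) = T f + T g)
     \<and> (\<forall>f\<in>space_of A. \<forall>a. T (a *\<^sub>R f) = a *\<^sub>R T f)
     \<and> (\<exists>K\<ge>0. \<forall>f C. A f C \<longrightarrow> B (T f) (K * C))"

definition gauge_iso ::
    "('a::real_vector \<Rightarrow> real \<Rightarrow> bool) \<Rightarrow> ('b::real_vector \<Rightarrow> real \<Rightarrow> bool) \<Rightarrow> bool" where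
  "gauge_iso A B \<longleftrightarrow> (\<exists>T S. bounded_op A B T \<and> bounded_op B A S
     \<and> (\<forall>f\<in>space_of A. S (T f) = f) \<and> (\<forall>g\<in>space_of B. T (S g) = g))"

definition complemented_in ::
    "('a::real_vector \<Rightarrow> real \<Rightarrow> bool) \<Rightarrow> ('b::real_vector \<Rightarrow> real \<Rightarrow> bool) \<Rightarrow> bool" where
  "complemented_in A B \<longleftrightarrow> (\<exists>i p. bounded_op A B i \<and> bounded_op B A p
     \<and> (\<forall>f\<in>space_of A. p (i f) = f))"

text \<open>This is the l_infinity-sum of the spaces \<open>B k\<close>: a single bound serves all
  indices.\<close>

definition family_gauge ::
    "('k \<Rightarrow> 'a \<Rightarrow> real \<Rightarrow> bool) \<Rightarrow> ('k \<Rightarrow> 'a) \<Rightarrow> real \<Rightarrow> bool" where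
  "family_gauge B z C \<longleftrightarrow> (\<forall>k. B k (z k) C)"

lemma gauge_relD:
  assumes "gauge_rel B"
  shows "B 0 0" "B f C \<Longrightarrow> B g D \<Longrightarrow> B (f + g) (C + D)" "B f C \<Longrightarrow> B (a *\<^sub>R f) (\<bar>a\<bar> * C)"
    "B f C \<Longrightarrow> C \<le> D \<Longrightarrow> B f D" "B f C \<Longrightarrow> 0 \<le> C"
  using assms unfolding gauge_rel_def by blast+

lemma gauge_rel_family_gauge:
  fixes B :: "'k \<Rightarrow> 'a::real_vector \<Rightarrow> real \<Rightarrow> bool"
  assumes "\<And>k. gauge_rel (B k)"
  shows "gauge_rel (family_gauge B)"
  unfolding gauge_rel_def family_gauge_def
  by (auto intro: gauge_relD[OF assms])

lemma space_of_subspace: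
  assumes "gauge_rel B"
  shows "0 \<in> space_of B" "f \<in> space_of B \<Longrightarrow> g \<in> space_of B \<Longrightarrow> f + g \<in> space_of B"
    "f \<in> space_of B \<Longrightarrow> a *\<^sub>R f \<in> space_of B"
  using gauge_relD[OF assms] unfolding space_of_def by blast+

lemma bounded_opD:
  assumes "bounded_op A B T" "f \<in> space_of A"
  shows "T f \<in> space_of B" "g \<in> space_of A \<Longrightarrow> T (f + g) = T f + T g" "T (a *\<^sub>R f) = a *\<^sub>R T f"
  using assms unfolding bounded_op_def space_of_def by blast+

lemma bounded_op_0:
  assumes "bounded_op A B T" "gauge_rel A"
  shows "T 0 = 0"
  using bounded_opD(3)[OF assms(1) space_of_subspace(1)[OF assms(2)], of 0] by simp

lemma bounded_op_diff:
  assumes "bounded_op A B T" "gauge_rel A" "f \<in> space_of A" "g \<in> space_of A"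
  shows "T (f - g) = T f - T g"
  using bounded_opD(2)[OF assms(1,3) space_of_subspace(3)[OF assms(2,4), of "-1"]]
    bounded_opD(3)[OF assms(1,4), of "-1"] by simp

lemma bounded_op_ident: "bounded_op A A (\<lambda>x. x)"
  unfolding bounded_op_def by (auto intro!: exI[of _ 1])

lemma bounded_op_compose:
  assumes T: "bounded_op A B T" and S: "bounded_op B C S"
  shows "bounded_op A C (\<lambda>x. S (T x))"
proof -
  obtain K L where "K \<ge> 0" "\<And>f D. A f D \<Longrightarrow> B (T f) (K * D)"
      "L \<ge> 0" "\<And>f D. B f D \<Longrightarrow> C (S f) (L * D)"
    using T S unfolding bounded_op_def by blast
  then have "\<exists>K\<ge>0. \<forall>f D. A f D \<longrightarrow> C (S (T f)) (K * D)"
    by (intro exI[of _ "L * K"]) (auto simp: mult.assoc)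
  then show ?thesis
    using bounded_opD[OF T] bounded_opD[OF S] unfolding bounded_op_def by auto
qed

lemma bounded_op_add_fun:
  assumes T: "bounded_op A B T" and S: "bounded_op A B S" and B: "gauge_rel B"
  shows "bounded_op A B (\<lambda>x. T x + S x)"
proof -
  obtain K L where "K \<ge> 0" "\<And>f D. A f D \<Longrightarrow> B (T f) (K * D)"
      "L \<ge> 0" "\<And>f D. A f D \<Longrightarrow> B (S f) (L * D)"
    using T S unfolding bounded_op_def by blast
  then have "\<exists>K\<ge>0. \<forall>f D. A f D \<longrightarrow> B (T f + S f) (K * D)"
    by (intro exI[of _ "K + L"]) (auto simp: distrib_right intro: gauge_relD(2)[OF B])
  then show ?thesis
    using bounded_opD[OF T] bounded_opD[OF S] unfolding bounded_op_def
    by (auto simp: scaleR_add_right)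
qed

lemma bounded_op_minus_fun:
  assumes T: "bounded_op A B T" and B: "gauge_rel B"
  shows "bounded_op A B (\<lambda>x. - T x)"
proof -
  obtain K where "K \<ge> 0" "\<And>f D. A f D \<Longrightarrow> B (T f) (K * D)"
    using T unfolding bounded_op_def by blast
  then have "\<exists>K\<ge>0. \<forall>f D. A f D \<longrightarrow> B (- T f) (K * D)"
    using gauge_relD(3)[OF B, of _ _ "-1"] by auto
  then show ?thesis
    using bounded_opD[OF T] unfolding bounded_op_def by auto
qed

lemma bounded_op_diff_fun:
  assumes "bounded_op A B T" "bounded_op A B S" "gauge_rel B"
  shows "bounded_op A B (\<lambda>x. T x - S x)"
  using bounded_op_add_fun[OF assms(1) bounded_op_minus_fun[OF assms(2,3)] assms(3)] by simp

lemma gauge_iso_sym: "gauge_iso A B \<Longrightarrow> gauge_iso B A"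
  unfolding gauge_iso_def by blast

lemma gauge_iso_trans:
  assumes "gauge_iso A B" "gauge_iso B C"
  shows "gauge_iso A C"
proof -
  obtain T S where T: "bounded_op A B T" "bounded_op B A S"
      "\<forall>f\<in>space_of A. S (T f) = f" "\<forall>g\<in>space_of B. T (S g) = g"
    using assms(1) unfolding gauge_iso_def by blast
  obtain T' S' where T': "bounded_op B C T'" "bounded_op C B S'"
      "\<forall>f\<in>space_of B. S' (T' f) = f" "\<forall>g\<in>space_of C. T' (S' g) = g"
    using assms(2) unfolding gauge_iso_def by blast
  show ?thesis
    unfolding gauge_iso_def
    by (rule exI[of _ "\<lambda>x. T' (T x)"], rule exI[of _ "\<lambda>x. S (S' x)"])
      (use T T' in \<open>auto intro: bounded_op_compose simp: bounded_opD(1)\<close>)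
qed

section \<open>The decomposition method\<close>

lemma bounded_op_eval: "bounded_op (family_gauge (\<lambda>_. B)) B (\<lambda>z. z k)"
  unfolding bounded_op_def family_gauge_def by (auto intro!: exI[of _ 1])

lemma bounded_op_map:
  assumes "bounded_op A B T"
  shows "bounded_op (family_gauge (\<lambda>_. A)) (family_gauge (\<lambda>_. B)) (\<lambda>z k. T (z k))"
proof -
  have "z k \<in> space_of A" if "z \<in> space_of (family_gauge (\<lambda>_. A))" for z and k :: 'c
    using that unfolding space_of_def family_gauge_def by blast
  moreover have "\<exists>K\<ge>0. \<forall>z C. family_gauge (\<lambda>_. A) z C
      \<longrightarrow> family_gauge (\<lambda>_. B) (\<lambda>k::'c. T (z k)) (K * C)"
    using assms unfolding bounded_op_def family_gauge_def by blast
  ultimately show ?thesis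
    using bounded_opD[OF assms] unfolding bounded_op_def by (auto simp: fun_eq_iff)
qed

lemma bounded_op_reindex:
  "bounded_op (family_gauge (\<lambda>_. B)) (family_gauge (\<lambda>_. B)) (\<lambda>z k. z (h k))"
  unfolding bounded_op_def family_gauge_def by (auto simp: fun_eq_iff intro!: exI[of _ 1])

lemma gauge_rel_zero: "gauge_rel B \<Longrightarrow> B f C \<Longrightarrow> B 0 C"
  using gauge_relD(1,4,5) by blast

lemma bounded_op_case_nat_0:
  assumes "gauge_rel B"
  shows "bounded_op (family_gauge (\<lambda>_. B)) (family_gauge (\<lambda>_. B)) (case_nat 0)"
proof -
  have "family_gauge (\<lambda>_. B) (case_nat 0 z) C" if "family_gauge (\<lambda>_. B) z C" for z C
    using that gauge_rel_zero[OF assms, of "z 0" C] unfolding family_gauge_def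
    by (simp split: nat.split)
  then show ?thesis
    unfolding bounded_op_def
    by (auto simp: fun_eq_iff split: nat.splits intro!: exI[of _ 1])
qed

lemma bounded_op_case_nat_head:
  assumes "gauge_rel B"
  shows "bounded_op B (family_gauge (\<lambda>_. B)) (\<lambda>f. case_nat f 0)"
proof -
  have "family_gauge (\<lambda>_. B) (case_nat f 0) C" if "B f C" for f C
    using that gauge_rel_zero[OF assms that] unfolding family_gauge_def
    by (simp split: nat.split)
  then show ?thesis
    unfolding bounded_op_def
    by (auto simp: fun_eq_iff split: nat.splits intro!: exI[of _ 1])
qed

text \<open>Pelczynski's argument. With \<open>w\<close> the projection of \<open>A\<close> onto the kernel of \<open>q\<close>, the space
  \<open>w A\<close> is isomorphic to \<open>P B\<close>, where \<open>P\<close> is a projection of \<open>B\<close>; so \<open>A\<close> is the sum of \<open>P B\<close> and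
  of the space of bounded sequences in \<open>B\<close>, and the extra summand is absorbed by a shift.\<close>

theorem gauge_iso_decomposition:
  fixes A :: "'a::real_vector \<Rightarrow> real \<Rightarrow> bool" and B :: "'b::real_vector \<Rightarrow> real \<Rightarrow> bool"
  assumes A: "gauge_rel A" and B: "gauge_rel B"
    and AB: "complemented_in A B"
    and BA: "complemented_in (family_gauge (\<lambda>_::nat. B)) A"
  shows "gauge_iso A (family_gauge (\<lambda>_::nat. B))"
proof -
  let ?Z = "family_gauge (\<lambda>_::nat. B)"
  have Z: "gauge_rel ?Z"
    by (rule gauge_rel_family_gauge[OF B])
  obtain a p where a: "bounded_op A B a" and p: "bounded_op B A p"
      and pa: "\<And>f. f \<in> space_of A \<Longrightarrow> p (a f) = f"
    using AB unfolding complemented_in_def by blast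
  obtain b q where b: "bounded_op ?Z A b" and q: "bounded_op A ?Z q"
      and qb: "\<And>z. z \<in> space_of ?Z \<Longrightarrow> q (b z) = z"
    using BA unfolding complemented_in_def by blast
  define w where "w x = x - b (q x)" for x
  define r where "r y = w (p y)" for y
  define P where "P y = a (r y)" for y
  define v where "v y = y - P y" for y
  have w: "bounded_op A A w"
    unfolding w_def[abs_def] by (intro bounded_op_diff_fun bounded_op_ident bounded_op_compose[OF q b] A)
  have r: "bounded_op B A r"
    unfolding r_def[abs_def] by (intro bounded_op_compose[OF p w])
  have P: "bounded_op B B P"
    unfolding P_def[abs_def] by (intro bounded_op_compose[OF r a])
  have v: "bounded_op B B v"
    unfolding v_def[abs_def] by (intro bounded_op_diff_fun bounded_op_ident P B)
  \<comment> \<open>Each coordinate splits into its \<open>P\<close> part and its \<open>v\<close>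
    part. The \<open>v\<close> parts of \<open>q x\<close> stay in place; the \<open>P\<close> parts
    move one place to the right, which frees the \<open>P\<close> part of coordinate 0 for
    \<open>a (w x)\<close>. The map \<open>u\<close> undoes the shift, and \<open>r\<close> reads
    \<open>w x\<close> off coordinate 0, whence \<open>x = b (q x) + w x\<close> is
    recovered.\<close>
  define T where "T = (\<lambda>x. (case_nat (a (w x)) 0 + case_nat 0 (\<lambda>m. P (q x m))) + (\<lambda>m. v (q x m)))"
  define u where "u = (\<lambda>z m. v (z m)) + (\<lambda>z m. P (z (Suc m)))"
  define S where "S = (\<lambda>z. b (u z) + r (z 0))"
  have T: "bounded_op A ?Z T"
    unfolding T_def
    by (intro bounded_op_add_fun Z
        bounded_op_compose[OF bounded_op_compose[OF w a] bounded_op_case_nat_head[OF B]]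
        bounded_op_compose[OF bounded_op_compose[OF q bounded_op_map[OF P]] bounded_op_case_nat_0[OF B]]
        bounded_op_compose[OF q bounded_op_map[OF v]])
  have u: "bounded_op ?Z ?Z u"
    unfolding u_def plus_fun_def[of "\<lambda>z m. v (z m)"]
    by (intro bounded_op_add_fun Z bounded_op_map[OF v]
        bounded_op_compose[OF bounded_op_reindex bounded_op_map[OF P]])
  have S: "bounded_op ?Z A S"
    unfolding S_def by (intro bounded_op_add_fun A bounded_op_compose[OF u b]
        bounded_op_compose[OF bounded_op_eval r])
  have spZ: "z m \<in> space_of B" if "z \<in> space_of ?Z" for z m
    using that unfolding space_of_def family_gauge_def by blast
  note mem = bounded_opD(1)[OF a] bounded_opD(1)[OF b] bounded_opD(1)[OF p] bounded_opD(1)[OF q]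
    bounded_opD(1)[OF w] bounded_opD(1)[OF r] bounded_opD(1)[OF P] bounded_opD(1)[OF v]
    bounded_opD(1)[OF u] bounded_opD(1)[OF T] bounded_opD(1)[OF S] spZ
  have qw: "q (w x) = 0" if "x \<in> space_of A" for x
    unfolding w_def using that by (subst bounded_op_diff[OF q A]) (auto simp: qb mem)
  have b0: "b 0 = 0" and a0: "a 0 = 0" and P0: "P 0 = 0" and v0: "v 0 = 0"
    using bounded_op_0[OF b Z] bounded_op_0[OF a A] bounded_op_0[OF P B] bounded_op_0[OF v B] .
  have ww: "w (w x) = w x" if "x \<in> space_of A" for x
    using qw[OF that] b0 unfolding w_def by (metis diff_zero)
  have wb: "w (b z) = 0" if "z \<in> space_of ?Z" for z
    using that by (simp add: w_def qb)
  \<comment> \<open>So \<open>a\<close> embeds the range of \<open>w\<close> into the range of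
    \<open>P\<close>, with \<open>r\<close> as inverse.\<close>
  have raw: "r (a (w x)) = w x" if "x \<in> space_of A" for x
    using that by (simp add: r_def pa mem ww)
  have wr: "w (r y) = r y" and qr: "q (r y) = 0" if "y \<in> space_of B" for y
    using that by (simp_all add: r_def mem ww qw)
  have rP: "r (P y) = r y" if "y \<in> space_of B" for y
    using raw[of "r y"] that by (simp add: P_def mem wr)
  have rv: "r (v y) = 0" and PP: "P (P y) = P y" if "y \<in> space_of B" for y
    unfolding v_def using that by (simp_all add: bounded_op_diff[OF r B] mem rP) (simp add: P_def rP[unfolded P_def])
  have Pv: "P (v y) = 0" and vP: "v (P y) = 0" and vv: "v (v y) = v y" if "y \<in> space_of B" for y
    using that rv[OF that] PP[OF that] by (auto simp: P_def a0 v_def)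
  show ?thesis
    unfolding gauge_iso_def
  proof (rule exI[of _ T], rule exI[of _ S], intro conjI ballI T S)
    fix x assume x: "x \<in> space_of A"
    have Paw: "P (a (w x)) = a (w x)"
      using x by (simp add: P_def raw)
    have "T x 0 = a (w x) + v (q x 0)" and TS: "\<And>m. T x (Suc m) = P (q x m) + v (q x (Suc m))"
      by (simp_all add: T_def)
    moreover from this have "r (T x 0) = w x"
      using x by (simp add: bounded_opD(2)[OF r] mem raw rv)
    moreover have "v (T x m) = v (q x m)" for m
      using x Paw by (cases m) (simp_all add: T_def bounded_opD(2)[OF v] mem vv vP v_def[of "a (w x)"])
    moreover have "P (T x (Suc m)) = P (q x m)" for m
      using x by (simp add: TS bounded_opD(2)[OF P] mem PP Pv)
    ultimately have "u (T x) = q x"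
      by (auto simp: u_def fun_eq_iff v_def)
    then show "S (T x) = x"
      using \<open>r (T x 0) = w x\<close> by (simp add: S_def w_def)
  next
    fix z assume z: "z \<in> space_of ?Z"
    have qS: "q (S z) = u z"
      using z by (simp add: S_def bounded_opD(2)[OF q] mem qb qr)
    have wS: "w (S z) = r (z 0)"
      using z by (simp add: S_def bounded_opD(2)[OF w] mem wb wr)
    have "v (u z m) = v (z m)" "P (u z m) = P (z (Suc m))" for m
      using z by (simp_all add: u_def bounded_opD(2)[OF v] bounded_opD(2)[OF P] mem vv vP PP Pv)
    then show "T (S z) = z"
      by (auto simp: T_def qS wS fun_eq_iff v_def P_def[of "z 0"] split: nat.splits)
  qed
qed

section \<open>Limits along ultrafilters\<close>

text \<open>Zorn's lemma yields a minimal proper filter below \<open>F\<close>. If the negation of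
  \<open>P\<close> does not hold eventually, adjoining \<open>P\<close> to this filter keeps it
  proper, so by minimality \<open>P\<close> belonged to it already.\<close>

lemma ultrafilter_below:
  fixes F :: "'a filter"
  assumes "F \<noteq> bot"
  obtains U where "U \<le> F" "U \<noteq> bot" "\<And>P. eventually P U \<or> eventually (\<lambda>x. \<not> P x) U"
proof -
  define S where "S = {G. G \<le> F \<and> G \<noteq> bot}"
  have "\<exists>U\<in>S. \<forall>G\<in>S. U \<ge> G \<longrightarrow> G = U"
  proof (rule predicate_Zorn)
    show "partial_order_on S (relation_of (\<ge>) S)"
      by (rule partial_order_on_relation_ofI) auto
  next
    fix C assume C: "C \<in> Chains (relation_of (\<ge>) S)"
    show "\<exists>u\<in>S. \<forall>a\<in>C. a \<ge> u"
    proof (cases "C = {}")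
      case True
      then show ?thesis
        using assms by (auto simp: S_def)
    next
      case False
      have CS: "C \<subseteq> S" and total: "\<And>G H. G \<in> C \<Longrightarrow> H \<in> C \<Longrightarrow> G \<le> H \<or> H \<le> G"
        using C unfolding Chains_def relation_of_def by auto
      \<comment> \<open>In a chain an event of the infimum is already an event of some member, so
        the infimum is proper.\<close>
      have "eventually P (Inf C) \<longleftrightarrow> (\<exists>G\<in>C. eventually P G)" for P
      proof (rule eventually_Inf_base[OF False])
        show "\<exists>x\<in>C. x \<le> inf G H" if "G \<in> C" "H \<in> C" for G H
          using total[OF that] that by auto
      qed
      then have "Inf C \<noteq> bot"
        using CS unfolding S_def trivial_limit_def by blast
      moreover have "Inf C \<le> F"
      proof -
        obtain G where "G \<in> C" using False by blast
        then show ?thesis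
          using CS Inf_lower[of G C] unfolding S_def by (auto intro: order_trans)
      qed
      ultimately show ?thesis
        by (intro bexI[of _ "Inf C"]) (auto simp: S_def Inf_lower)
    qed
  qed
  then obtain U where U: "U \<in> S" and min: "\<And>G. G \<in> S \<Longrightarrow> G \<le> U \<Longrightarrow> G = U"
    by blast
  have "eventually P U" if "\<not> eventually (\<lambda>x. \<not> P x) U" for P
  proof -
    let ?G = "inf U (principal {x. P x})"
    have "?G \<noteq> bot"
      using that by (auto simp: trivial_limit_def eventually_inf_principal)
    moreover have "?G \<le> U"
      by simp
    ultimately have "?G = U"
      using U le_infI1[of U F] by (intro min) (auto simp: S_def)
    moreover have "eventually P ?G"
      by (simp add: eventually_inf_principal)
    ultimately show ?thesis
      by simp
  qed
  then show ?thesis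
    using that U unfolding S_def by blast
qed

text \<open>Compactness of the interval gives a cluster point of \<open>u\<close>. An ultrafilter
  decides every event, so a cluster point is a limit.\<close>

lemma ultrafilter_tendsto:
  fixes u :: "'a \<Rightarrow> real"
  assumes "U \<noteq> bot" "\<And>P. eventually P U \<or> eventually (\<lambda>x. \<not> P x) U"
    and "\<And>k. \<bar>u k\<bar> \<le> C"
  shows "(u \<longlongrightarrow> Lim U u) U"
proof -
  have "u k \<in> {-C..C}" for k
    using assms(3)[of k] by auto
  then have "filtermap u U \<noteq> bot" "eventually (\<lambda>x. x \<in> {-C..C}) (filtermap u U)"
    using assms(1) by (simp_all add: filtermap_bot_iff eventually_filtermap)
  then obtain l where l: "inf (nhds l) (filtermap u U) \<noteq> bot"
    using compact_Icc[of "-C" C] unfolding compact_filter by blast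
  have "eventually P (filtermap u U)" if "eventually P (nhds l)" for P
  proof (rule ccontr)
    assume "\<not> ?thesis"
    then have "eventually (\<lambda>x. \<not> P x) (filtermap u U)"
      using assms(2)[of "\<lambda>x. P (u x)"] by (auto simp: eventually_filtermap)
    with that have "eventually (\<lambda>_. False) (inf (nhds l) (filtermap u U))"
      unfolding eventually_inf by blast
    with l show False
      by (simp add: trivial_limit_def)
  qed
  then have "(u \<longlongrightarrow> l) U"
    by (auto simp: filterlim_def intro: filter_leI)
  then show ?thesis
    using tendsto_Lim[OF assms(1)] by metis
qed

section \<open>Lipschitz functions on sets of bounded families\<close>

text \<open>This is l_infinity over an arbitrary index type, a common ambient space for
  \<open>linf\<close>, \<open>c0\<close> and the cubes; here the supremum in \<open>sup_dist\<close>
  is over a bounded set, and so \<open>sup_dist\<close> is a metric.\<close>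

definition bounded_families :: "('i \<Rightarrow> real) set" where
  "bounded_families = {x. bounded (range x)}"

lemma sup_dist_upper:
  assumes "x \<in> bounded_families" "y \<in> bounded_families"
  shows "\<bar>x i - y i\<bar> \<le> sup_dist x y"
proof -
  have "bounded (range (\<lambda>i. x i - y i))"
    using assms unfolding bounded_families_def by (intro bounded_minus_comp) auto
  then have "bdd_above (range (\<lambda>i. \<bar>x i - y i\<bar>))"
    unfolding bounded_real bdd_above_def by auto
  then show ?thesis
    unfolding sup_dist_def by (intro cSUP_upper) auto
qed

lemma sup_dist_least: "(\<And>i. \<bar>x i - y i\<bar> \<le> C) \<Longrightarrow> sup_dist x y \<le> C"
  unfolding sup_dist_def by (intro cSUP_least) auto

lemma sup_dist_nonneg:
  assumes "x \<in> bounded_families" "y \<in> bounded_families"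
  shows "0 \<le> sup_dist x y"
  using sup_dist_upper[OF assms, of undefined] by linarith

lemma sup_dist_self [simp]: "sup_dist x x = 0"
  by (simp add: sup_dist_def)

lemma sup_dist_commute: "sup_dist x y = sup_dist y x"
  by (simp add: sup_dist_def abs_minus_commute)

lemma sup_dist_triangle:
  assumes "x \<in> bounded_families" "y \<in> bounded_families" "z \<in> bounded_families"
  shows "sup_dist x z \<le> sup_dist x y + sup_dist y z"
proof (rule sup_dist_least)
  show "\<bar>x i - z i\<bar> \<le> sup_dist x y + sup_dist y z" for i
    using sup_dist_upper[OF assms(1,2), of i] sup_dist_upper[OF assms(2,3), of i] by linarith
qed

text \<open>Nonnegativity of \<open>C\<close> is explicit because on a single point, such as
  \<open>cube 0\<close>, every constant satisfies the Lipschitz condition.\<close>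

definition lip_gauge :: "('i \<Rightarrow> real) set \<Rightarrow> (('i \<Rightarrow> real) \<Rightarrow> real) \<Rightarrow> real \<Rightarrow> bool" where
  "lip_gauge X f C \<longleftrightarrow> f (\<lambda>_. 0) = 0 \<and> (\<forall>x. x \<notin> X \<longrightarrow> f x = 0) \<and> 0 \<le> C
     \<and> (\<forall>x\<in>X. \<forall>y\<in>X. \<bar>f x - f y\<bar> \<le> C * sup_dist x y)"

lemma lip_gaugeD:
  assumes "lip_gauge X f C"
  shows "f (\<lambda>_. 0) = 0" "x \<notin> X \<Longrightarrow> f x = 0" "0 \<le> C"
    "x \<in> X \<Longrightarrow> y \<in> X \<Longrightarrow> \<bar>f x - f y\<bar> \<le> C * sup_dist x y"
  using assms unfolding lip_gauge_def by blast+

lemma gauge_rel_lip_gauge: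
  assumes "X \<subseteq> bounded_families"
  shows "gauge_rel (lip_gauge X)"
  unfolding gauge_rel_def
proof (intro conjI allI impI)
  fix f g C D
  assume f: "lip_gauge X f C" and g: "lip_gauge X g D"
  have "\<bar>f x + g x - (f y + g y)\<bar> \<le> (C + D) * sup_dist x y" if "x \<in> X" "y \<in> X" for x y
    using lip_gaugeD(4)[OF f that] lip_gaugeD(4)[OF g that] by (simp add: distrib_right)
  then show "lip_gauge X (f + g) (C + D)"
    using lip_gaugeD[OF f] lip_gaugeD[OF g] unfolding lip_gauge_def by simp
next
  fix f C a
  assume f: "lip_gauge X f C"
  have "\<bar>a * f x - a * f y\<bar> \<le> \<bar>a\<bar> * C * sup_dist x y" if "x \<in> X" "y \<in> X" for x y
    using mult_left_mono[OF lip_gaugeD(4)[OF f that] abs_ge_zero[of a]]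
    by (simp add: abs_mult[symmetric] right_diff_distrib mult.assoc)
  then show "lip_gauge X (a *\<^sub>R f) (\<bar>a\<bar> * C)"
    using lip_gaugeD[OF f] unfolding lip_gauge_def by simp
next
  fix f C D
  assume f: "lip_gauge X f C" and "C \<le> D"
  have "\<bar>f x - f y\<bar> \<le> D * sup_dist x y" if "x \<in> X" "y \<in> X" for x y
    using lip_gaugeD(4)[OF f that] mult_right_mono[OF \<open>C \<le> D\<close> sup_dist_nonneg]
      subsetD[OF assms] that by (meson order_trans)
  then show "lip_gauge X f D"
    using lip_gaugeD[OF f] \<open>C \<le> D\<close> unfolding lip_gauge_def by simp
qed (auto simp: lip_gauge_def)

lemma space_of_lip_gauge:
  assumes "X \<subseteq> bounded_families"
  shows "space_of (lip_gauge X) = Lip0 X"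
proof (intro set_eqI iffI)
  fix f
  assume "f \<in> Lip0 X"
  then obtain L where f: "f (\<lambda>_. 0) = 0" "\<forall>x. x \<notin> X \<longrightarrow> f x = 0"
      and L: "\<forall>x\<in>X. \<forall>y\<in>X. \<bar>f x - f y\<bar> \<le> L * sup_dist x y"
    unfolding Lip0_def by blast
  \<comment> \<open>The constant in \<open>Lip0\<close> may be negative; its absolute value also
    works.\<close>
  have "\<bar>f x - f y\<bar> \<le> \<bar>L\<bar> * sup_dist x y" if "x \<in> X" "y \<in> X" for x y
    using L that mult_right_mono[OF abs_ge_self[of L] sup_dist_nonneg]
      subsetD[OF assms] by (meson order_trans)
  then show "f \<in> space_of (lip_gauge X)"
    using f unfolding space_of_def lip_gauge_def by (auto intro!: exI[of _ "\<bar>L\<bar>"])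
qed (auto simp: space_of_def lip_gauge_def Lip0_def)

lemma lipnorm_le: "lip_gauge X f C \<Longrightarrow> lipnorm X f \<le> C"
  unfolding lipnorm_def lip_gauge_def by (intro cInf_lower) auto

text \<open>The infimum defining the norm is attained: at positive distance the difference quotient
  is a lower bound of all admissible constants, and at distance zero both sides vanish.\<close>

lemma lip_gauge_lipnorm:
  assumes X: "X \<subseteq> bounded_families" and f: "f \<in> Lip0 X"
  shows "lip_gauge X f (lipnorm X f)"
proof -
  let ?S = "{L. 0 \<le> L \<and> (\<forall>x\<in>X. \<forall>y\<in>X. \<bar>f x - f y\<bar> \<le> L * sup_dist x y)}"
  obtain C where C: "lip_gauge X f C"
    using f space_of_lip_gauge[OF X] unfolding space_of_def by blast
  then have ne: "?S \<noteq> {}"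
    unfolding lip_gauge_def by blast
  have "\<bar>f x - f y\<bar> \<le> Inf ?S * sup_dist x y" if xy: "x \<in> X" "y \<in> X" for x y
  proof (cases "sup_dist x y = 0")
    case True
    then show ?thesis
      using lip_gaugeD(4)[OF C xy] by simp
  next
    case False
    then have pos: "sup_dist x y > 0"
      using sup_dist_nonneg[of x y] subsetD[OF X xy(1)] subsetD[OF X xy(2)] by simp
    have "\<bar>f x - f y\<bar> / sup_dist x y \<le> Inf ?S"
      using ne xy pos by (intro cInf_greatest) (auto simp: pos_divide_le_eq)
    then show ?thesis
      using pos by (simp add: pos_divide_le_eq)
  qed
  moreover have "0 \<le> Inf ?S"
    using ne by (intro cInf_greatest) auto
  ultimately show ?thesis
    using lip_gaugeD[OF C] unfolding lip_gauge_def lipnorm_def by blast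
qed

lemma lip0_isomorphic_if_gauge_iso:
  assumes X: "X \<subseteq> bounded_families" and Y: "Y \<subseteq> bounded_families"
    and iso: "gauge_iso (lip_gauge X) (lip_gauge Y)"
  shows "lip0_isomorphic X Y"
proof -
  obtain T S where T: "bounded_op (lip_gauge X) (lip_gauge Y) T"
      and S: "bounded_op (lip_gauge Y) (lip_gauge X) S"
      and ST: "\<forall>f\<in>Lip0 X. S (T f) = f" and TS: "\<forall>g\<in>Lip0 Y. T (S g) = g"
    using iso unfolding gauge_iso_def space_of_lip_gauge[OF X] space_of_lip_gauge[OF Y] by blast
  note memT = bounded_opD(1)[OF T, unfolded space_of_lip_gauge[OF X] space_of_lip_gauge[OF Y]]
  note memS = bounded_opD(1)[OF S, unfolded space_of_lip_gauge[OF X] space_of_lip_gauge[OF Y]]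
  obtain K where K: "K \<ge> 0" "\<And>f C. lip_gauge X f C \<Longrightarrow> lip_gauge Y (T f) (K * C)"
    using T unfolding bounded_op_def by blast
  obtain L where L: "L \<ge> 0" "\<And>f C. lip_gauge Y f C \<Longrightarrow> lip_gauge X (S f) (L * C)"
    using S unfolding bounded_op_def by blast
  have "bij_betw T (Lip0 X) (Lip0 Y)"
    by (rule bij_betw_byWitness[of _ S]) (use ST TS memT memS in auto)
  moreover have "T (\<lambda>x. a * f x + b * g x) = (\<lambda>y. a * T f y + b * T g y)"
    if f: "f \<in> Lip0 X" and g: "g \<in> Lip0 X" for f g a b
  proof -
    have fg: "f \<in> space_of (lip_gauge X)" "g \<in> space_of (lip_gauge X)"
      using f g by (simp_all add: space_of_lip_gauge[OF X])
    have "T (a *\<^sub>R f + b *\<^sub>R g) = a *\<^sub>R T f + b *\<^sub>R T g"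
      using bounded_opD(2)[OF T space_of_subspace(3,3)[OF gauge_rel_lip_gauge[OF X]]] fg
      by (simp add: bounded_opD(3)[OF T])
    then show ?thesis
      by (simp add: fun_eq_iff plus_fun_def scaleR_fun_def)
  qed
  \<comment> \<open>One positive constant must serve both estimates: \<open>K\<close> bounds
    \<open>T\<close>, \<open>L\<close> bounds its inverse, and 1 ensures positivity.\<close>
  moreover have "lipnorm Y (T f) \<le> (K + L + 1) * lipnorm X f
      \<and> lipnorm X f \<le> (K + L + 1) * lipnorm Y (T f)" if f: "f \<in> Lip0 X" for f
  proof -
    have fX: "lip_gauge X f (lipnorm X f)" and fY: "lip_gauge Y (T f) (lipnorm Y (T f))"
      using f by (simp_all add: lip_gauge_lipnorm X Y memT)
    have "lipnorm Y (T f) \<le> K * lipnorm X f"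
      by (intro lipnorm_le K fX)
    moreover have "lipnorm X f \<le> L * lipnorm Y (T f)"
      using L(2)[OF fY] ST f by (intro lipnorm_le) simp
    moreover have "0 \<le> lipnorm X f" "0 \<le> lipnorm Y (T f)"
      using fX fY by (auto dest: lip_gaugeD(3))
    ultimately show ?thesis
      using mult_nonneg_nonneg[OF K(1)] mult_nonneg_nonneg[OF L(1)]
      by (simp add: distrib_right add_increasing add_increasing2)
  qed
  ultimately show ?thesis
    unfolding lip0_isomorphic_def using K(1) L(1)
    by (intro exI[of _ T] conjI exI[of _ "K + L + 1"]) auto
qed

section \<open>Finite-dimensional cubes\<close>

definition clip :: "real \<Rightarrow> real" where
  "clip t = max (-1) (min 1 t)"

lemma clip_eq: "\<bar>t\<bar> \<le> 1 \<Longrightarrow> clip t = t"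
  by (simp add: clip_def)

definition cube :: "nat \<Rightarrow> (nat \<Rightarrow> real) set" where
  "cube n = {b. (\<forall>j. \<bar>b j\<bar> \<le> 1) \<and> (\<forall>j\<ge>n. b j = 0)}"

text \<open>Clipping sends every family into the cube. For \<open>R > 0\<close> the map contracts
  distances by the factor \<open>R\<close>, and it samples exactly where the entries are at most
  \<open>R\<close> in absolute value.\<close>

definition compress :: "nat \<Rightarrow> (nat \<Rightarrow> 'i) \<Rightarrow> real \<Rightarrow> ('i \<Rightarrow> real) \<Rightarrow> nat \<Rightarrow> real" where
  "compress n s R x = (\<lambda>j. if j < n then clip (x (s j) / R) else 0)"

text \<open>Indices with \<open>n \<le> P i\<close> are sent to \<open>0\<close>, as members of \<open>cube n\<close> vanish there.\<close>

definition expand :: "('i \<Rightarrow> nat) \<Rightarrow> real \<Rightarrow> (nat \<Rightarrow> real) \<Rightarrow> 'i \<Rightarrow> real" where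
  "expand P R b = (\<lambda>i. R * b (P i))"

lemma cube_bounded_families: "cube n \<subseteq> bounded_families"
  unfolding cube_def bounded_families_def bounded_real by auto

lemma zero_in_cube: "(\<lambda>_. 0) \<in> cube n"
  by (simp add: cube_def)

lemma compress_in_cube: "compress n s R x \<in> cube n"
  by (auto simp: compress_def cube_def clip_def)

lemma compress_0 [simp]: "compress n s R (\<lambda>_. 0) = (\<lambda>_. 0)"
  by (auto simp: compress_def clip_def)

lemma expand_0 [simp]: "expand P R (\<lambda>_. 0) = (\<lambda>_. 0)"
  by (auto simp: expand_def)

lemma sup_dist_compress:
  assumes "x \<in> bounded_families" "y \<in> bounded_families" "R > 0"
  shows "R * sup_dist (compress n s R x) (compress n s R y) \<le> sup_dist x y"
proof -
  have "\<bar>clip (a / R) - clip (b / R)\<bar> \<le> \<bar>a - b\<bar> / R" for a b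
  proof -
    have "\<bar>clip (a / R) - clip (b / R)\<bar> \<le> \<bar>a / R - b / R\<bar>"
      unfolding clip_def by linarith
    then show ?thesis
      using assms(3) by (simp flip: diff_divide_distrib)
  qed
  then have "\<bar>clip (x i / R) - clip (y i / R)\<bar> \<le> sup_dist x y / R" for i
    by (rule order_trans[OF _ divide_right_mono[OF sup_dist_upper[OF assms(1,2)]]])
      (use assms(3) in auto)
  then have "sup_dist (compress n s R x) (compress n s R y) \<le> sup_dist x y / R"
    using sup_dist_nonneg[OF assms(1,2)] assms(3)
    by (intro sup_dist_least) (auto simp: compress_def)
  then show ?thesis
    using assms(3) by (simp add: pos_le_divide_eq mult.commute)
qed

lemma sup_dist_expand:
  assumes "b \<in> cube n" "c \<in> cube n" "R \<ge> 0"
  shows "sup_dist (expand P R b) (expand P R c) \<le> R * sup_dist b c"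
proof (rule sup_dist_least)
  fix i
  show "\<bar>expand P R b i - expand P R c i\<bar> \<le> R * sup_dist b c"
    using mult_left_mono[OF sup_dist_upper[of b c "P i"] assms(3)] assms cube_bounded_families[of n]
    by (auto simp: expand_def abs_mult simp flip: right_diff_distrib)
qed

section \<open>Lipschitz functions on an approximable set\<close>

text \<open>Dividing by \<open>R k\<close> after \<open>expand\<close>, and multiplying by it after
  \<open>compress\<close>, cancels the change of scale, so neither direction enlarges Lipschitz
  constants. By \<open>approx\<close> the sets of indices that almost fix a given point have the
  finite intersection property. Along an ultrafilter containing them the values recovered from
  \<open>f\<close> tend to \<open>f x\<close>; for a general member of the sum the limit exists by
  boundedness alone.\<close>

lemma complemented_in_cubes:
  fixes X :: "('i \<Rightarrow> real) set" and n :: "'k \<Rightarrow> nat"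
  assumes X: "X \<subseteq> bounded_families" and zero: "(\<lambda>_. 0) \<in> X"
    and R: "\<And>k. R k > 0"
    and expand_X: "\<And>k b. b \<in> cube (n k) \<Longrightarrow> expand (P k) (R k) b \<in> X"
    and approx: "\<And>G e. finite G \<Longrightarrow> G \<subseteq> X \<Longrightarrow> e > 0 \<Longrightarrow>
      \<exists>k. \<forall>x\<in>G. sup_dist (expand (P k) (R k) (compress (n k) (s k) (R k) x)) x < e"
  shows "complemented_in (lip_gauge X) (family_gauge (\<lambda>k. lip_gauge (cube (n k))))"
proof -
  let ?Z = "family_gauge (\<lambda>k. lip_gauge (cube (n k)))"
  define c where "c k = compress (n k) (s k) (R k)" for k
  define ex where "ex k = expand (P k) (R k)" for k
  have c_cube: "c k x \<in> cube (n k)" and c0: "c k (\<lambda>_. 0) = (\<lambda>_. 0)" for k x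
    by (simp_all add: c_def compress_in_cube)
  have ex_X: "ex k b \<in> X" if "b \<in> cube (n k)" for k b
    using expand_X[OF that] by (simp add: ex_def)
  have ex0: "ex k (\<lambda>_. 0) = (\<lambda>_. 0)" for k
    by (simp add: ex_def)

  define F where "F = (INF (x, e) \<in> X \<times> {0<..}. principal {k. sup_dist (ex k (c k x)) x < e})"
  have "F \<noteq> bot"
    unfolding F_def
  proof (rule INF_filter_not_bot)
    fix S :: "(('i \<Rightarrow> real) \<times> real) set"
    assume S: "S \<subseteq> X \<times> {0<..}" "finite S"
    \<comment> \<open>Inserting 1 keeps the minimum meaningful when \<open>S\<close> is
      empty.\<close>
    let ?e = "Min (insert 1 (snd ` S))"
    have "?e > 0"
      using S by (subst Min_gr_iff) auto
    moreover have "finite (fst ` S)" "fst ` S \<subseteq> X"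
      using S by auto
    ultimately obtain k where k: "\<And>x. x \<in> fst ` S \<Longrightarrow> sup_dist (ex k (c k x)) x < ?e"
      using approx[of "fst ` S" ?e] unfolding c_def ex_def by blast
    have "sup_dist (ex k (c k x)) x < e" if "(x, e) \<in> S" for x e
    proof -
      have "e \<in> insert 1 (snd ` S)" and x: "x \<in> fst ` S"
        using that by (auto intro: rev_image_eqI)
      then have "?e \<le> e"
        using S(2) by (intro Min_le) auto
      then show ?thesis
        using k[OF x] by linarith
    qed
    then have "k \<in> (\<Inter>(x, e)\<in>S. {k. sup_dist (ex k (c k x)) x < e})"
      by blast
    moreover have "(INF (x, e)\<in>S. principal {k. sup_dist (ex k (c k x)) x < e})
        = principal (\<Inter>(x, e)\<in>S. {k. sup_dist (ex k (c k x)) x < e})"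
      using INF_principal_finite[OF S(2), of "\<lambda>(x, e). {k. sup_dist (ex k (c k x)) x < e}"]
      by (simp add: case_prod_unfold)
    ultimately show "(INF (x, e)\<in>S. principal {k. sup_dist (ex k (c k x)) x < e}) \<noteq> bot"
      by (simp only: principal_eq_bot_iff) blast
  qed
  then obtain U where UF: "U \<le> F" and U: "U \<noteq> bot"
      "\<And>P. eventually P U \<or> eventually (\<lambda>x. \<not> P x) U"
    by (rule ultrafilter_below) blast
  have close: "eventually (\<lambda>k. sup_dist (ex k (c k x)) x < e) U" if "x \<in> X" "e > 0" for x e
  proof -
    have "F \<le> principal {k. sup_dist (ex k (c k x)) x < e}"
      unfolding F_def by (rule INF_lower2[of "(x, e)"]) (use that in auto)
    then show ?thesis
      using UF by (simp add: le_principal filter_leD)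
  qed

  \<comment> \<open>\<open>a\<close> restricts \<open>f\<close> to the rescaled cubes,
    \<open>u g x k\<close> is the value at \<open>x\<close> predicted by block \<open>k\<close>, and
    \<open>p\<close> is the limit of the predictions.\<close>
  define u where "u g x k = R k * g k (c k x)" for g x k
  define p where "p g x = (if x \<in> X then Lim U (u g x) else 0)" for g x
  define a where "a f k b = (if b \<in> cube (n k) then f (ex k b) / R k else 0)" for f k b

  have u_lip: "\<bar>u g x k - u g y k\<bar> \<le> C * sup_dist x y"
    if g: "?Z g C" and xy: "x \<in> X" "y \<in> X" for g C x y k
  proof -
    have gk: "lip_gauge (cube (n k)) (g k) C"
      using g by (simp add: family_gauge_def)
    have "\<bar>u g x k - u g y k\<bar> = R k * \<bar>g k (c k x) - g k (c k y)\<bar>"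
      using R[of k] by (simp add: u_def abs_mult flip: right_diff_distrib)
    also have "\<dots> \<le> R k * (C * sup_dist (c k x) (c k y))"
      using R[of k] lip_gaugeD(4)[OF gk c_cube c_cube] by (intro mult_left_mono) auto
    also have "\<dots> = C * (R k * sup_dist (c k x) (c k y))"
      by simp
    also have "\<dots> \<le> C * sup_dist x y"
      using sup_dist_compress[OF subsetD[OF X xy(1)] subsetD[OF X xy(2)] R] lip_gaugeD(3)[OF gk]
      unfolding c_def by (intro mult_left_mono) auto
    finally show ?thesis .
  qed
  have u_0: "u g (\<lambda>_. 0) k = 0" if g: "g \<in> space_of ?Z" for g k
  proof -
    obtain C where "lip_gauge (cube (n k)) (g k) C"
      using g unfolding space_of_def family_gauge_def by blast
    then show ?thesis
      by (simp add: u_def c0 lip_gaugeD(1))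
  qed
  have lim: "(u g x \<longlongrightarrow> p g x) U" if g: "g \<in> space_of ?Z" and x: "x \<in> X" for g x
  proof -
    obtain C where C: "?Z g C"
      using g unfolding space_of_def by blast
    \<comment> \<open>Comparison with the origin, where every prediction is 0, gives a bound uniform
      in \<open>k\<close>.\<close>
    have "\<bar>u g x k\<bar> \<le> C * sup_dist x (\<lambda>_. 0)" for k
      using u_lip[OF C x zero, of k] u_0[OF g, of k] by simp
    then have "(u g x \<longlongrightarrow> Lim U (u g x)) U"
      by (rule ultrafilter_tendsto[OF U])
    then show ?thesis
      using x by (simp add: p_def)
  qed

  have "bounded_op (lip_gauge X) ?Z a"
    unfolding bounded_op_def
  proof (intro conjI ballI allI exI[of _ 1] impI)
    fix f C assume f: "lip_gauge X f C"
    have "\<bar>f (ex k b) / R k - f (ex k d) / R k\<bar> \<le> C * sup_dist b d"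
      if "b \<in> cube (n k)" "d \<in> cube (n k)" for k b d
    proof -
      have "\<bar>f (ex k b) - f (ex k d)\<bar> \<le> C * sup_dist (ex k b) (ex k d)"
        using lip_gaugeD(4)[OF f] ex_X that by blast
      also have "\<dots> \<le> C * (R k * sup_dist b d)"
        using lip_gaugeD(3)[OF f] sup_dist_expand[OF that less_imp_le[OF R], of "P k"]
        unfolding ex_def by (intro mult_left_mono) auto
      finally show ?thesis
        using R[of k] by (simp add: pos_divide_le_eq mult.commute mult.left_commute
            flip: diff_divide_distrib)
    qed
    then show "?Z (a f) (1 * C)"
      using lip_gaugeD(1,3)[OF f] unfolding family_gauge_def lip_gauge_def a_def by (simp add: ex0)
  qed (auto simp: a_def fun_eq_iff add_divide_distrib)
  moreover have "bounded_op ?Z (lip_gauge X) p"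
    unfolding bounded_op_def
  proof (intro conjI ballI allI exI[of _ 1] impI)
    fix f g assume fg: "f \<in> space_of ?Z" "g \<in> space_of ?Z"
    show "p (f + g) = p f + p g"
    proof
      fix x
      have "(u (f + g) x \<longlongrightarrow> p f x + p g x) U" if "x \<in> X"
        using tendsto_add[OF lim[OF fg(1) that] lim[OF fg(2) that]]
        by (rule tendsto_cong[THEN iffD1, rotated]) (simp add: u_def distrib_left)
      then show "p (f + g) x = (p f + p g) x"
        using tendsto_Lim[OF U(1)] by (auto simp: p_def)
    qed
  next
    fix f r assume f: "f \<in> space_of ?Z"
    show "p (r *\<^sub>R f) = r *\<^sub>R p f"
    proof
      fix x
      have "(u (r *\<^sub>R f) x \<longlongrightarrow> r * p f x) U" if "x \<in> X"
        using tendsto_mult_left[OF lim[OF f that], of r]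
        by (rule tendsto_cong[THEN iffD1, rotated]) (simp add: u_def mult.left_commute)
      then show "p (r *\<^sub>R f) x = (r *\<^sub>R p f) x"
        using tendsto_Lim[OF U(1)] by (auto simp: p_def)
    qed
  next
    fix g C assume g: "?Z g C"
    then have gs: "g \<in> space_of ?Z"
      unfolding space_of_def by blast
    have "\<bar>p g x - p g y\<bar> \<le> C * sup_dist x y" if xy: "x \<in> X" "y \<in> X" for x y
      by (rule tendsto_upperbound[OF tendsto_rabs[OF tendsto_diff[OF lim[OF gs xy(1)] lim[OF gs xy(2)]]] _ U(1)])
        (simp add: u_lip[OF g xy])
    moreover have "p g (\<lambda>_. 0) = 0"
      by (rule tendsto_unique[OF U(1) lim[OF gs zero]], rule tendsto_eventually) (simp add: u_0[OF gs])
    moreover have "0 \<le> C"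
      using g lip_gaugeD(3) unfolding family_gauge_def by blast
    ultimately show "lip_gauge X (p g) (1 * C)"
      unfolding lip_gauge_def by (simp add: p_def)
  qed auto
  moreover have "p (a f) = f" if f: "f \<in> space_of (lip_gauge X)" for f
  proof
    fix x
    obtain C where C: "lip_gauge X f C"
      using f unfolding space_of_def by blast
    show "p (a f) x = f x"
    proof (cases "x \<in> X")
      case False
      then show ?thesis
        using lip_gaugeD(2)[OF C] by (simp add: p_def)
    next
      case True
      have u_eq: "u (a f) x k = f (ex k (c k x))" for k
        using R[of k] by (simp add: u_def a_def c_cube)
      have "((\<lambda>k. sup_dist (ex k (c k x)) x) \<longlongrightarrow> 0) U"
        using close[OF True] sup_dist_nonneg[OF subsetD[OF X ex_X[OF c_cube]] subsetD[OF X True]]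
        by (auto simp: tendsto_iff dist_real_def)
      then have lim0: "((\<lambda>k. C * sup_dist (ex k (c k x)) x) \<longlongrightarrow> 0) U"
        by (rule tendsto_mult_right_zero)
      have "(u (a f) x \<longlongrightarrow> f x) U"
        unfolding u_eq
        by (rule Lim_transform2[OF tendsto_const])
          (rule Lim_null_comparison[OF _ lim0], use lip_gaugeD(4)[OF C True ex_X[OF c_cube]] in \<open>auto simp: sup_dist_commute\<close>)
      then show ?thesis
        using tendsto_Lim[OF U(1)] True by (simp add: p_def)
    qed
  qed
  ultimately show ?thesis
    unfolding complemented_in_def by blast
qed

text \<open>The balls of radius 2 around the centres are disjoint, since the centres are 4 apart, so
  the blocks can be extended by bump functions without overlap. The origin lies in none of the open
  balls, so the extension vanishes there. Conversely, a function is restricted to the cells and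
  normalised by subtracting its value at the centre.\<close>

lemma cubes_complemented_in:
  fixes X :: "('i \<Rightarrow> real) set" and n :: "'k \<Rightarrow> nat"
  assumes X: "X \<subseteq> bounded_families"
    and centre: "\<And>k. p k \<in> X" "\<And>k. 2 \<le> sup_dist (\<lambda>_. 0) (p k)"
      "\<And>k l. k \<noteq> l \<Longrightarrow> 4 \<le> sup_dist (p k) (p l)"
    and cell: "\<And>k b. b \<in> cube (n k) \<Longrightarrow> (\<lambda>i. p k i + b (P k i)) \<in> X"
    and P: "\<And>k j. j < n k \<Longrightarrow> P k (s k j) = j"
  shows "complemented_in (family_gauge (\<lambda>k. lip_gauge (cube (n k)))) (lip_gauge X)"
proof -
  let ?Z = "family_gauge (\<lambda>k. lip_gauge (cube (n k)))"
  note bX = subsetD[OF X]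
  define c where "c k x = compress (n k) (s k) 1 (\<lambda>i. x i - p k i)" for k x
  \<comment> \<open>The bump is 1 up to distance 1 from the centre, hence on the whole cell, and 0
    from distance 2 on.\<close>
  define bump where "bump k x = max 0 (min 1 (2 - sup_dist x (p k)))" for k x
  define h where "h g k x = bump k x * g k (c k x)" for g k x
  \<comment> \<open>If no such \<open>k\<close> exists, the choice is irrelevant: all \<open>h g k x\<close> vanish.\<close>
  define near where "near x = (SOME k. sup_dist x (p k) < 2)" for x
  define i where "i g x = (if x \<in> X then h g (near x) x else 0)" for g x
  define pt where "pt k b = (\<lambda>i. p k i + b (P k i))" for k b
  define q where "q f k b = (if b \<in> cube (n k) then f (pt k b) - f (p k) else 0)"
    for f :: "_ \<Rightarrow> real" and k b
  have near_eq: "near x = k" if x: "x \<in> X" and k: "sup_dist x (p k) < 2" for x k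
  proof (rule ccontr)
    assume "near x \<noteq> k"
    then have "4 \<le> sup_dist (p (near x)) (p k)"
      by (rule centre(3))
    moreover have "sup_dist x (p (near x)) < 2"
      unfolding near_def by (rule someI[where P = "\<lambda>k. sup_dist x (p k) < 2", OF k])
    ultimately show False
      using k sup_dist_triangle[OF bX[OF centre(1)] bX[OF x] bX[OF centre(1)], of "near x" k]
        sup_dist_commute[of x "p (near x)"] by linarith
  qed
  have h_far: "h g k x = 0" if "2 \<le> sup_dist x (p k)" for g k x
    using that by (simp add: h_def bump_def)
  have h_near: "h g k x = 0" if "x \<in> X" "near x \<noteq> k" for g k x
    using near_eq[OF that(1)] that(2) h_far by (meson not_le)

  have h_lip: "\<bar>h g k x - h g k y\<bar> \<le> 2 * C * sup_dist x y"
    if g: "?Z g C" and x: "x \<in> X" and y: "y \<in> X" for g C k x y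
  proof -
    have gk: "lip_gauge (cube (n k)) (g k) C"
      using g by (simp add: family_gauge_def)
    note C = lip_gaugeD(3)[OF gk]
    have c_cube: "c k z \<in> cube (n k)" for z
      by (simp add: c_def compress_in_cube)
    have bdd: "(\<lambda>i. z i - p k i) \<in> bounded_families" if "z \<in> X" for z
      using bX[OF that] bX[OF centre(1)[of k]] unfolding bounded_families_def
      by (auto intro: bounded_minus_comp)
    have "sup_dist (c k x) (c k y) \<le> sup_dist (\<lambda>i. x i - p k i) (\<lambda>i. y i - p k i)"
      using sup_dist_compress[OF bdd[OF x] bdd[OF y], of 1 "n k" "s k"] by (simp add: c_def)
    also have "\<dots> = sup_dist x y"
      by (simp add: sup_dist_def)
    finally have "C * sup_dist (c k x) (c k y) \<le> C * sup_dist x y"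
      using C by (rule mult_left_mono)
    then have g_lip: "\<bar>g k (c k x) - g k (c k y)\<bar> \<le> C * sup_dist x y"
      using lip_gaugeD(4)[OF gk c_cube c_cube, of x y] by linarith
    have "sup_dist (c k y) (\<lambda>_. 0) \<le> 1"
      using c_cube[of y] by (intro sup_dist_least) (auto simp: cube_def)
    then have "C * sup_dist (c k y) (\<lambda>_. 0) \<le> C"
      using mult_left_mono[OF _ C] by fastforce
    then have g_bdd: "\<bar>g k (c k y)\<bar> \<le> C"
      using lip_gaugeD(4)[OF gk c_cube zero_in_cube, of y] lip_gaugeD(1)[OF gk] by simp
    have "\<bar>sup_dist x (p k) - sup_dist y (p k)\<bar> \<le> sup_dist x y"
      using sup_dist_triangle[OF bX[OF x] bX[OF y] bX[OF centre(1)], of k]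
        sup_dist_triangle[OF bX[OF y] bX[OF x] bX[OF centre(1)], of k]
        sup_dist_commute[of x y] by linarith
    then have bump_lip: "\<bar>bump k x - bump k y\<bar> \<le> sup_dist x y" and bump1: "\<bar>bump k x\<bar> \<le> 1"
      unfolding bump_def by linarith+
    \<comment> \<open>Product rule: the bump is 1-Lipschitz and at most 1, while the block is
      \<open>C\<close>-Lipschitz and at most \<open>C\<close> on the cube, whose points have norm at
      most 1. This gives the constant \<open>2 * C\<close>.\<close>
    have "h g k x - h g k y = bump k x * (g k (c k x) - g k (c k y)) + (bump k x - bump k y) * g k (c k y)"
      by (simp add: h_def algebra_simps)
    then have "\<bar>h g k x - h g k y\<bar> \<le> \<bar>bump k x\<bar> * \<bar>g k (c k x) - g k (c k y)\<bar> + \<bar>bump k x - bump k y\<bar> * \<bar>g k (c k y)\<bar>"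
      by (metis abs_mult abs_triangle_ineq)
    also have "\<dots> \<le> 1 * (C * sup_dist x y) + sup_dist x y * C"
      using g_lip g_bdd bump_lip bump1 by (intro add_mono mult_mono) auto
    finally show ?thesis
      by simp
  qed

  have "bounded_op ?Z (lip_gauge X) i"
    unfolding bounded_op_def
  proof (intro conjI ballI allI exI[of _ 4] impI)
    fix g C assume g: "?Z g C"
    have C: "0 \<le> C"
      using g lip_gaugeD(3) unfolding family_gauge_def by blast
    have "\<bar>i g x - i g y\<bar> \<le> 4 * C * sup_dist x y" if x: "x \<in> X" and y: "y \<in> X" for x y
    proof (cases "near x = near y")
      case True
      then have "\<bar>i g x - i g y\<bar> \<le> 2 * C * sup_dist x y"
        using h_lip[OF g x y, of "near x"] x y by (simp add: i_def)
      moreover have "0 \<le> C * sup_dist x y"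
        using C sup_dist_nonneg[OF bX[OF x] bX[OF y]] by simp
      ultimately show ?thesis
        by linarith
    next
      case False
      \<comment> \<open>The difference is the sum of the differences of \<open>h g (near x)\<close>
        and of \<open>h g (near y)\<close>, each costing \<open>2 * C\<close>; hence the factor
        4.\<close>
      then have "h g (near x) y = 0" "h g (near y) x = 0"
        using h_near x y by metis+
      then show ?thesis
        using h_lip[OF g x y, of "near x"] h_lip[OF g x y, of "near y"] x y by (simp add: i_def)
    qed
    then show "lip_gauge X (i g) (4 * C)"
      using C h_far[OF centre(2)] unfolding lip_gauge_def by (simp add: i_def)
  qed (auto simp: i_def h_def fun_eq_iff algebra_simps)
  moreover have "bounded_op (lip_gauge X) ?Z q"
    unfolding bounded_op_def
  proof (intro conjI ballI allI exI[of _ 1] impI)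
    fix f C assume f: "lip_gauge X f C"
    have "\<bar>f (pt k b) - f (pt k d)\<bar> \<le> C * sup_dist b d"
      if bd: "b \<in> cube (n k)" "d \<in> cube (n k)" for k b d
    proof -
      have "sup_dist (pt k b) (pt k d) \<le> sup_dist b d"
        using sup_dist_upper[OF subsetD[OF cube_bounded_families] subsetD[OF cube_bounded_families], OF bd]
        by (intro sup_dist_least) (simp add: pt_def)
      then have "C * sup_dist (pt k b) (pt k d) \<le> C * sup_dist b d"
        using lip_gaugeD(3)[OF f] by (rule mult_left_mono)
      then show ?thesis
        using lip_gaugeD(4)[OF f cell[OF bd(1)] cell[OF bd(2)]] by (simp add: pt_def)
    qed
    then show "?Z (q f) (1 * C)"
      using lip_gaugeD(3)[OF f] unfolding family_gauge_def lip_gauge_def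
      by (auto simp: q_def pt_def)
  qed (auto simp: q_def fun_eq_iff algebra_simps)
  moreover have "q (i g) = g" if g: "g \<in> space_of ?Z" for g
  proof (intro ext)
    fix k b
    obtain C where gk: "lip_gauge (cube (n k)) (g k) C"
      using g unfolding space_of_def family_gauge_def by blast
    show "q (i g) k b = g k b"
    proof (cases "b \<in> cube (n k)")
      case False
      then show ?thesis
        using lip_gaugeD(2)[OF gk] by (simp add: q_def)
    next
      case True
      have value_at: "i g (pt k d) = g k d" if d: "d \<in> cube (n k)" for d
      proof -
        have "sup_dist (pt k d) (p k) \<le> 1"
          using d by (intro sup_dist_least) (auto simp: pt_def cube_def)
        then have "bump k (pt k d) = 1" and "near (pt k d) = k"
          using near_eq cell[OF d] by (simp_all add: bump_def pt_def)
        moreover have "c k (pt k d) = d"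
        proof
          fix j
          show "c k (pt k d) j = d j"
          proof (cases "j < n k")
            case True
            then show ?thesis
              using d clip_eq[of "d j"] by (simp add: c_def compress_def pt_def P cube_def)
          next
            case False
            then show ?thesis
              using d by (simp add: c_def compress_def cube_def)
          qed
        qed
        ultimately show ?thesis
          using cell[OF d] by (simp add: i_def h_def pt_def)
      qed
      have "i g (p k) = 0"
        using value_at[OF zero_in_cube] lip_gaugeD(1)[OF gk] by (simp add: pt_def)
      then show ?thesis
        using True by (simp add: q_def value_at)
    qed
  qed
  ultimately show ?thesis
    unfolding complemented_in_def by blast
qed

text \<open>Bounded sequences in an l_infinity-sum form the l_infinity-sum over pairs of indices, so
  a single family of cells suffices later.\<close>

lemma complemented_in_curry:
  fixes B :: "'k \<Rightarrow> 'a::real_vector \<Rightarrow> real \<Rightarrow> bool"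
  assumes "complemented_in (family_gauge (\<lambda>(m::'m, k). B k)) A"
  shows "complemented_in (family_gauge (\<lambda>_::'m. family_gauge B)) A"
proof -
  let ?F = "family_gauge (\<lambda>(m::'m, k). B k)" and ?G = "family_gauge (\<lambda>_::'m. family_gauge B)"
  obtain i p where i: "bounded_op ?F A i" and p: "bounded_op A ?F p"
      and pi: "\<And>f. f \<in> space_of ?F \<Longrightarrow> p (i f) = f"
    using assms unfolding complemented_in_def by blast
  have FG: "?F (\<lambda>(m, k). z m k) C \<longleftrightarrow> ?G z C" for z C
    by (simp add: family_gauge_def)
  have "bounded_op ?G ?F (\<lambda>z (m, k). z m k)"
    unfolding bounded_op_def by (auto simp: FG fun_eq_iff intro!: exI[of _ 1])
  moreover have "bounded_op ?F ?G (\<lambda>z m k. z (m, k))"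
    unfolding bounded_op_def by (auto simp: family_gauge_def fun_eq_iff intro!: exI[of _ 1])
  moreover have "(\<lambda>(m, k). z m k) \<in> space_of ?F" if "z \<in> space_of ?G" for z
    using that FG unfolding space_of_def by blast
  ultimately show ?thesis
    unfolding complemented_in_def using bounded_op_compose[OF _ i] bounded_op_compose[OF p]
    by (intro exI[of _ "\<lambda>z. i (\<lambda>(m, k). z m k)"] exI[of _ "\<lambda>f m k. p f (m, k)"]) (auto simp: pi)
qed

section \<open>Encodings by real numbers\<close>

text \<open>Reals correspond to sets of naturals, and a sequence of such sets is coded as one set by
  pairing each element with its position.\<close>

lemma real_sequence_encoding:
  obtains e :: "(nat \<Rightarrow> real) \<Rightarrow> real" where "inj e"
proof -
  obtain f :: "nat set \<Rightarrow> real" where f: "bij f"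
    using nat_sets_eqpoll_reals unfolding eqpoll_def by blast
  define e where "e w = f {prod_encode (m, j) |m j. j \<in> inv f (w m)}" for w
  have "inj e"
  proof (rule injI, rule ext)
    fix v w m
    assume "e v = e w"
    then have "{prod_encode (m, j) |m j. j \<in> inv f (v m)} = {prod_encode (m, j) |m j. j \<in> inv f (w m)}"
      unfolding e_def by (rule injD[OF bij_is_inj[OF f]])
    then have "prod_encode (m, j) \<in> {prod_encode (m, j) |m j. j \<in> inv f (v m)}
        \<longleftrightarrow> prod_encode (m, j) \<in> {prod_encode (m, j) |m j. j \<in> inv f (w m)}" for j
      by simp
    then have "inv f (v m) = inv f (w m)"
      by (auto simp: set_eq_iff)
    then show "v m = w m"
      using bij_is_surj[OF f] by (metis surj_f_inv_f)
  qed
  then show ?thesis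
    by (rule that)
qed

text \<open>This labels all cells of the sequence space by distinct reals, from which separated
  centres are built.\<close>

lemma index_encoding:
  obtains c :: "nat \<times> real \<times> nat \<Rightarrow> real" where "inj c"
proof -
  obtain e :: "(nat \<Rightarrow> real) \<Rightarrow> real" where e: "inj e"
    by (rule real_sequence_encoding)
  have "inj (\<lambda>(m, r, n). e (case_nat (real m) (case_nat r (\<lambda>_. real n))))"
  proof (rule injI)
    fix p q :: "nat \<times> real \<times> nat"
    assume "(\<lambda>(m, r, n). e (case_nat (real m) (case_nat r (\<lambda>_. real n)))) p
        = (\<lambda>(m, r, n). e (case_nat (real m) (case_nat r (\<lambda>_. real n)))) q"
    moreover obtain m r n m' r' n' where pq: "p = (m, r, n)" "q = (m', r', n')"
      by (cases p, cases q)
    ultimately have "e (case_nat (real m) (case_nat r (\<lambda>_. real n)))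
        = e (case_nat (real m') (case_nat r' (\<lambda>_. real n')))"
      by simp
    then have eq: "case_nat (real m) (case_nat r (\<lambda>_. real n)) j
        = case_nat (real m') (case_nat r' (\<lambda>_. real n')) j" for j
      using e by (auto dest: injD)
    show "p = q"
      using eq[of 0] eq[of 1] eq[of 2] by (simp add: pq numeral_2_eq_2)
  qed
  then show ?thesis
    by (rule that)
qed

text \<open>The bound is at least 1 so that it survives the \<open>max 1\<close> used when scales
  are decoded.\<close>

lemma finite_bounded_families_bound:
  assumes "finite G" "G \<subseteq> bounded_families"
  shows "\<exists>R\<ge>1. \<forall>x\<in>G. \<forall>i. \<bar>x i\<bar> \<le> R"
  using assms
proof (induction rule: finite_induct)
  case (insert x G)
  then obtain R where "R \<ge> 1" "\<forall>x\<in>G. \<forall>i. \<bar>x i\<bar> \<le> R"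
    by auto
  moreover obtain C where "\<forall>i. \<bar>x i\<bar> \<le> C"
    using insert.prems unfolding bounded_families_def bounded_real by auto
  ultimately show ?case
    by (intro exI[of _ "max R C"]) (auto simp: le_max_iff_disj)
qed auto

lemma scaled_clip:
  assumes "\<bar>t\<bar> \<le> R" "R > 0"
  shows "R * clip (t / R) = t"
  using assms by (subst clip_eq) simp_all

section \<open>The space of bounded sequences\<close>

text \<open>This is \<open>Z\<close>: the natural number is the dimension, and the real supplies
  continuum many copies of each cube.\<close>

abbreviation cubes_gauge :: "(real \<times> nat \<Rightarrow> (nat \<Rightarrow> real) \<Rightarrow> real) \<Rightarrow> real \<Rightarrow> bool" where
  "cubes_gauge \<equiv> family_gauge (\<lambda>k. lip_gauge (cube (snd k)))"

lemma linf_eq: "linf = bounded_families"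
  by (simp add: linf_def bounded_families_def)

text \<open>Indices are grouped by the integer parts of \<open>x i / d\<close> for all
  \<open>x\<close> in \<open>G\<close>. Boundedness leaves finitely many groups, and within a group
  each \<open>x\<close> varies by at most \<open>d\<close>.\<close>

lemma finite_quantization:
  fixes G :: "(nat \<Rightarrow> real) set"
  assumes G: "finite G" "G \<subseteq> bounded_families" and d: "d > 0"
  shows "\<exists>(P :: nat \<Rightarrow> nat) n s. (\<forall>i. P i < n) \<and> (\<forall>x\<in>G. \<forall>i. \<bar>x (s (P i)) - x i\<bar> \<le> d)"
proof -
  obtain R where R: "R \<ge> 1" "\<And>x i. x \<in> G \<Longrightarrow> \<bar>x i\<bar> \<le> R"
    using finite_bounded_families_bound[OF G] by blast
  \<comment> \<open>Restricting to \<open>G\<close> places the profiles in a finite set of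
    functions.\<close>
  define Q where "Q i = restrict (\<lambda>x. \<lfloor>x i / d\<rfloor>) G" for i
  have "\<lfloor>x i / d\<rfloor> \<in> {\<lfloor>- R / d\<rfloor>..\<lfloor>R / d\<rfloor>}" if "x \<in> G" for x i
  proof -
    have "- R \<le> x i" "x i \<le> R"
      using R(2)[OF that, of i] by auto
    then have "\<lfloor>- R / d\<rfloor> \<le> \<lfloor>x i / d\<rfloor>" "\<lfloor>x i / d\<rfloor> \<le> \<lfloor>R / d\<rfloor>"
      using d by (intro floor_mono divide_right_mono; simp)+
    then show ?thesis
      by simp
  qed
  then have "range Q \<subseteq> G \<rightarrow>\<^sub>E {\<lfloor>- R / d\<rfloor>..\<lfloor>R / d\<rfloor>}"
    unfolding Q_def by (intro image_subsetI restrict_PiE_iff[THEN iffD2]) blast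
  then have "finite (range Q)"
    by (rule finite_subset) (intro finite_PiE G(1) finite_atLeastAtMost_int)
  then obtain h where h: "bij_betw h (range Q) {0..<card (range Q)}"
    using ex_bij_betw_finite_nat by blast
  define P where "P i = h (Q i)" for i
  define s where "s j = (SOME i. P i = j)" for j
  show ?thesis
  proof (intro exI conjI allI ballI)
    show "P i < card (range Q)" for i
      using bij_betwE[OF h] by (auto simp: P_def)
    show "\<bar>x (s (P i)) - x i\<bar> \<le> d" if "x \<in> G" for x i
    proof -
      have "P (s (P i)) = P i"
        unfolding s_def by (rule someI[of _ i]) simp
      then have "Q (s (P i)) = Q i"
        using inj_on_eq_iff[OF bij_betw_imp_inj_on[OF h] rangeI rangeI] unfolding P_def by blast
      then have "\<lfloor>x (s (P i)) / d\<rfloor> = \<lfloor>x i / d\<rfloor>"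
        using that by (auto simp: Q_def dest!: fun_cong[of _ _ x])
      then have "\<bar>x (s (P i)) / d - x i / d\<bar> \<le> 1"
        by linarith
      then show ?thesis
        using d by (simp flip: diff_divide_distrib)
    qed
  qed
qed

text \<open>Scale, representatives and partition together form one sequence, so a real codes them.
  Codes outside the range of the encoding are harmless: \<open>max 1\<close> keeps the scale
  positive, and any expansion of a cube is bounded.\<close>

lemma Lip_linf_complemented_in_cubes: "complemented_in (lip_gauge linf) cubes_gauge"
proof -
  obtain e :: "(nat \<Rightarrow> real) \<Rightarrow> real" where e: "inj e"
    by (rule real_sequence_encoding)
  \<comment> \<open>The first component of an index codes a sequence: entry 0 is the scale, the odd entries form
    the map \<open>s\<close> choosing representatives, the other even entries the partition \<open>P\<close>.\<close>
  define R where "R k = max 1 (inv e (fst k) 0)" for k :: "real \<times> nat"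
  define s where "s k j = nat \<lfloor>inv e (fst k) (2 * j + 1)\<rfloor>" for k :: "real \<times> nat" and j
  define P where "P k i = nat \<lfloor>inv e (fst k) (2 * i + 2)\<rfloor>" for k :: "real \<times> nat" and i
  show ?thesis
  proof (rule complemented_in_cubes[where P = P and R = R and s = s])
    show "linf \<subseteq> bounded_families" "(\<lambda>_. 0) \<in> linf"
      by (auto simp: linf_def bounded_families_def)
    show "R k > 0" for k
      by (simp add: R_def)
    show "expand (P k) (R k) b \<in> linf" if "b \<in> cube (snd k)" for k b
    proof -
      have "\<bar>R k * b (P k i)\<bar> \<le> \<bar>R k\<bar>" for i
        using that by (simp add: cube_def abs_mult mult_left_le)
      then show ?thesis
        unfolding linf_def bounded_real expand_def by blast
    qed
  next
    fix G :: "(nat \<Rightarrow> real) set" and d :: real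
    assume G: "finite G" "G \<subseteq> linf" and d: "d > 0"
    obtain R0 where R0: "R0 \<ge> 1" "\<And>x i. x \<in> G \<Longrightarrow> \<bar>x i\<bar> \<le> R0"
      using finite_bounded_families_bound[OF G[unfolded linf_eq]] by blast
    \<comment> \<open>Accuracy \<open>d / 2\<close> leaves room for the strict inequality after
      taking the supremum.\<close>
    obtain P0 :: "nat \<Rightarrow> nat" and n s0 where P0: "\<And>i. P0 i < n"
        and s0: "\<And>x i. x \<in> G \<Longrightarrow> \<bar>x (s0 (P0 i)) - x i\<bar> \<le> d / 2"
      using finite_quantization[OF G[unfolded linf_eq] half_gt_zero[OF d]] by blast
    \<comment> \<open>For \<open>t = 2 * j + 1\<close> the quotient \<open>t div 2\<close> is
      \<open>j\<close>; for \<open>t = 2 * i + 2\<close> it is \<open>i + 1\<close>, hence the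
      subtraction of 1.\<close>
    define w where "w t = (if t = 0 then R0 else if odd t then real (s0 (t div 2))
        else real (P0 (t div 2 - 1)))" for t
    define k where "k = (e w, n)"
    have k: "R k = R0" "s k j = s0 j" "P k i = P0 i" "snd k = n" for i j
      using R0(1) by (simp_all add: R_def s_def P_def k_def inv_f_f[OF e] w_def)
    have "sup_dist (expand (P k) (R k) (compress (snd k) (s k) (R k) x)) x < d" if x: "x \<in> G" for x
    proof -
      have "expand (P k) (R k) (compress (snd k) (s k) (R k) x) i = x (s0 (P0 i))" for i
        using R0(1) by (simp add: expand_def compress_def k P0 scaled_clip[OF R0(2)[OF x]])
      then have "sup_dist (expand (P k) (R k) (compress (snd k) (s k) (R k) x)) x \<le> d / 2"
        using s0[OF x] by (intro sup_dist_least) simp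
      then show ?thesis
        using d by simp
    qed
    then show "\<exists>k. \<forall>x\<in>G. sup_dist (expand (P k) (R k) (compress (snd k) (s k) (R k) x)) x < d"
      by blast
  qed
qed

text \<open>The centres are 4 times indicators of distinct sets of naturals, preceded by an entry 4
  that keeps even the empty set away from the origin. The cube of a cell occupies the first
  coordinates.\<close>

lemma cubes_complemented_in_Lip_linf:
  "complemented_in (family_gauge (\<lambda>_::nat. cubes_gauge)) (lip_gauge linf)"
proof (rule complemented_in_curry)
  obtain c :: "nat \<times> real \<times> nat \<Rightarrow> real" where c: "inj c"
    by (rule index_encoding)
  obtain f :: "nat set \<Rightarrow> real" where f: "bij f"
    using nat_sets_eqpoll_reals unfolding eqpoll_def by blast
  define p :: "nat \<times> real \<times> nat \<Rightarrow> nat \<Rightarrow> real"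
    where "p k = case_nat 4 (\<lambda>i. if i \<in> inv f (c k) then 4 else 0)" for k
  have p_bound: "\<bar>p k i\<bar> \<le> 4" for k i
    by (auto simp: p_def split: nat.split)
  then have p_bdd: "p k \<in> bounded_families" for k
    unfolding bounded_families_def bounded_real by blast
  have "complemented_in (family_gauge (\<lambda>k::nat \<times> real \<times> nat. lip_gauge (cube (snd (snd k))))) (lip_gauge linf)"
  proof (rule cubes_complemented_in[where p = p and P = "\<lambda>_ i. i" and s = "\<lambda>_ j. j"])
    show "linf \<subseteq> bounded_families" "p k \<in> linf" for k
      using p_bdd by (simp_all add: linf_eq)
    show "2 \<le> sup_dist (\<lambda>_. 0) (p k)" for k
      using sup_dist_upper[of "\<lambda>_. 0" "p k" 0] p_bdd[of k]
      by (simp add: bounded_families_def p_def)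
    show "4 \<le> sup_dist (p k) (p l)" if "k \<noteq> l" for k l
    proof -
      have "inv f (c k) \<noteq> inv f (c l)"
        using that by (simp add: inj_eq[OF c] inj_eq[OF bij_is_inj[OF bij_imp_bij_inv[OF f]]])
      then obtain i where "i \<in> inv f (c k) \<longleftrightarrow> i \<notin> inv f (c l)"
        by blast
      then have "\<bar>p k (Suc i) - p l (Suc i)\<bar> = 4"
        by (auto simp: p_def)
      then show ?thesis
        using sup_dist_upper[OF p_bdd[of k] p_bdd[of l], of "Suc i"] by simp
    qed
    show "(\<lambda>i. p k i + b i) \<in> linf" if "b \<in> cube (snd (snd k))" for k b
      using p_bdd[of k] subsetD[OF cube_bounded_families that] bounded_plus_comp[of "p k" UNIV b]
      unfolding linf_eq bounded_families_def by simp
  qed (rule refl)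
  then show "complemented_in (family_gauge (\<lambda>(m::nat, k::real \<times> nat). lip_gauge (cube (snd k)))) (lip_gauge linf)"
    by (simp add: case_prod_unfold)
qed

section \<open>The space of null families\<close>

lemma c0_bounded_families: "c0 \<subseteq> bounded_families"
proof
  fix x :: "'i \<Rightarrow> real"
  assume "x \<in> c0"
  then have "finite {i. 1 \<le> \<bar>x i\<bar>}"
    by (simp add: c0_def)
  then have "bounded (x ` {i. 1 \<le> \<bar>x i\<bar>} \<union> {-1..1})"
    by (simp add: finite_imp_bounded)
  moreover have "x i \<in> x ` {i. 1 \<le> \<bar>x i\<bar>} \<union> {-1..1}" for i
    by (cases "1 \<le> \<bar>x i\<bar>") auto
  ultimately have "bounded (range x)"
    by (blast intro: bounded_subset)
  then show "x \<in> bounded_families"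
    by (simp add: bounded_families_def)
qed

lemma finite_support_in_c0:
  assumes "finite S" "\<And>i. i \<notin> S \<Longrightarrow> x i = 0"
  shows "x \<in> c0"
proof -
  have "{i. d \<le> \<bar>x i\<bar>} \<subseteq> S" if "d > 0" for d
    using assms(2) that by force
  then have "finite {i. d \<le> \<bar>x i\<bar>}" if "d > 0" for d
    by (rule finite_subset) (use that assms(1) in auto)
  then show ?thesis
    by (simp add: c0_def)
qed

text \<open>Off a finite set of indices all members of \<open>G\<close> are small, so restriction to
  that set almost fixes them. The scale and an enumeration of the set form a sequence, coded by a
  real.\<close>

lemma Lip_c0_complemented_in_cubes:
  "complemented_in (lip_gauge (c0 :: (real \<Rightarrow> real) set)) cubes_gauge"
proof -
  obtain e :: "(nat \<Rightarrow> real) \<Rightarrow> real" where e: "inj e"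
    by (rule real_sequence_encoding)
  define R where "R k = max 1 (inv e (fst k) 0)" for k :: "real \<times> nat"
  define s where "s k j = inv e (fst k) (Suc j)" for k :: "real \<times> nat" and j
  \<comment> \<open>\<open>P k\<close> inverts \<open>s k\<close> on its first \<open>snd k\<close>
    entries, choosing one preimage if an arbitrary code repeats values. All other indices go to
    \<open>snd k\<close>, where the cube vanishes, so expansions have finite support.\<close>
  define P where "P k i = (if i \<in> s k ` {..<snd k} then inv_into {..<snd k} (s k) i else snd k)" for k i
  have P_less: "P k i < snd k \<longleftrightarrow> i \<in> s k ` {..<snd k}" for k i
    using inv_into_into[of i "s k" "{..<snd k}"] by (auto simp: P_def)
  have sP: "s k (P k i) = i" if "i \<in> s k ` {..<snd k}" for k i
    using that by (simp add: P_def f_inv_into_f)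
  show ?thesis
  proof (rule complemented_in_cubes[where P = P and R = R and s = s])
    show "(c0 :: (real \<Rightarrow> real) set) \<subseteq> bounded_families"
      by (rule c0_bounded_families)
    show "(\<lambda>_. 0) \<in> c0"
      by (rule finite_support_in_c0[of "{}"]) auto
    show "R k > 0" for k
      by (simp add: R_def)
    show "expand (P k) (R k) b \<in> c0" if "b \<in> cube (snd k)" for k b
      by (rule finite_support_in_c0[of "s k ` {..<snd k}"])
        (use that in \<open>auto simp: expand_def cube_def P_def\<close>)
  next
    fix G :: "(real \<Rightarrow> real) set" and d :: real
    assume G: "finite G" "G \<subseteq> c0" and d: "d > 0"
    obtain R0 where R0: "R0 \<ge> 1" "\<And>x i. x \<in> G \<Longrightarrow> \<bar>x i\<bar> \<le> R0"
      using finite_bounded_families_bound[OF G(1) order_trans[OF G(2) c0_bounded_families]] by blast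
    define S where "S = (\<Union>x\<in>G. {i. d / 2 \<le> \<bar>x i\<bar>})"
    have "finite S"
    proof -
      have "finite {i. d / 2 \<le> \<bar>x i\<bar>}" if "x \<in> G" for x
        using subsetD[OF G(2) that] half_gt_zero[OF d] unfolding c0_def by blast
      then show ?thesis
        unfolding S_def using G(1) by blast
    qed
    then obtain s0 :: "nat \<Rightarrow> real" where s0: "bij_betw s0 {0..<card S} S"
      using ex_bij_betw_nat_finite by blast
    define k where "k = (e (case_nat R0 s0), card S)"
    have k: "R k = R0" "s k j = s0 j" "snd k = card S" for j
      using R0(1) by (simp_all add: R_def s_def k_def inv_f_f[OF e])
    have range_s: "s k ` {..<snd k} = S"
      using s0 by (simp add: k bij_betw_def atLeast0LessThan)
    have "sup_dist (expand (P k) (R k) (compress (snd k) (s k) (R k) x)) x < d" if x: "x \<in> G" for x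
    proof -
      have "\<bar>expand (P k) (R k) (compress (snd k) (s k) (R k) x) i - x i\<bar> \<le> d / 2" for i
      proof (cases "i \<in> S")
        case True
        then show ?thesis
          using R0(1) d P_less[of k i] sP[of i k] scaled_clip[OF R0(2)[OF x, of i]]
          by (simp add: expand_def compress_def range_s k(1))
      next
        case False
        then have "\<bar>x i\<bar> < d / 2"
          using x by (force simp: S_def)
        then show ?thesis
          using False P_less[of k i] by (simp add: expand_def compress_def range_s)
      qed
      then have "sup_dist (expand (P k) (R k) (compress (snd k) (s k) (R k) x)) x \<le> d / 2"
        by (rule sup_dist_least)
      then show ?thesis
        using d by simp
    qed
    then show "\<exists>k. \<forall>x\<in>G. sup_dist (expand (P k) (R k) (compress (snd k) (s k) (R k) x)) x < d"
      by blast
  qed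
qed

text \<open>The centres are 4 times distinct unit vectors. Every cell of dimension \<open>n\<close>
  uses the coordinates 0 to \<open>n - 1\<close>, viewed as reals, so its points have finite
  support.\<close>

lemma cubes_complemented_in_Lip_c0:
  "complemented_in (family_gauge (\<lambda>_::nat. cubes_gauge)) (lip_gauge (c0 :: (real \<Rightarrow> real) set))"
proof (rule complemented_in_curry)
  obtain c :: "nat \<times> real \<times> nat \<Rightarrow> real" where c: "inj c"
    by (rule index_encoding)
  define p :: "nat \<times> real \<times> nat \<Rightarrow> real \<Rightarrow> real"
    where "p k i = (if i = c k then 4 else 0)" for k i
  define P :: "nat \<times> real \<times> nat \<Rightarrow> real \<Rightarrow> nat"
    where "P k i = (if i \<in> real ` {..<snd (snd k)} then nat \<lfloor>i\<rfloor> else snd (snd k))" for k i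
  have p_c0: "p k \<in> c0" for k
    by (rule finite_support_in_c0[of "{c k}"]) (auto simp: p_def)
  note p_bdd = subsetD[OF c0_bounded_families p_c0]
  have "complemented_in (family_gauge (\<lambda>k::nat \<times> real \<times> nat. lip_gauge (cube (snd (snd k)))))
      (lip_gauge (c0 :: (real \<Rightarrow> real) set))"
  proof (rule cubes_complemented_in[where p = p and P = P and s = "\<lambda>_. real"])
    show "(c0 :: (real \<Rightarrow> real) set) \<subseteq> bounded_families" "p k \<in> c0" for k
      by (rule c0_bounded_families p_c0)+
    show "2 \<le> sup_dist (\<lambda>_. 0) (p k)" for k
      using sup_dist_upper[of "\<lambda>_. 0" "p k" "c k"] p_bdd[of k]
      by (simp add: bounded_families_def p_def)
    show "4 \<le> sup_dist (p k) (p l)" if "k \<noteq> l" for k l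
      using sup_dist_upper[OF p_bdd[of k] p_bdd[of l], of "c k"] that by (simp add: p_def inj_eq[OF c])
    show "(\<lambda>i. p k i + b (P k i)) \<in> c0" if "b \<in> cube (snd (snd k))" for k b
      by (rule finite_support_in_c0[of "insert (c k) (real ` {..<snd (snd k)})"])
        (use that in \<open>auto simp: p_def P_def cube_def\<close>)
    show "P k (real j) = j" if "j < snd (snd k)" for k j
      using that by (simp add: P_def)
  qed
  then show "complemented_in (family_gauge (\<lambda>(m::nat, k::real \<times> nat). lip_gauge (cube (snd k))))
      (lip_gauge (c0 :: (real \<Rightarrow> real) set))"
    by (simp add: case_prod_unfold)
qed

section \<open>Comparison through the common space of bounded sequences\<close>

theorem mainTheorem6:
  shows "lip0_isomorphic linf (c0 :: (real \<Rightarrow> real) set)"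
proof (rule lip0_isomorphic_if_gauge_iso)
  show linf: "linf \<subseteq> bounded_families"
    by (simp add: linf_eq)
  show c0: "(c0 :: (real \<Rightarrow> real) set) \<subseteq> bounded_families"
    by (rule c0_bounded_families)
  have cubes: "gauge_rel cubes_gauge"
    by (intro gauge_rel_family_gauge gauge_rel_lip_gauge cube_bounded_families)
  show "gauge_iso (lip_gauge linf) (lip_gauge (c0 :: (real \<Rightarrow> real) set))"
    by (rule gauge_iso_trans[OF _ gauge_iso_sym])
      (rule gauge_iso_decomposition[OF gauge_rel_lip_gauge[OF linf] cubes
          Lip_linf_complemented_in_cubes cubes_complemented_in_Lip_linf],
        rule gauge_iso_decomposition[OF gauge_rel_lip_gauge[OF c0] cubes
          Lip_c0_complemented_in_cubes cubes_complemented_in_Lip_c0])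
qed

end
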